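(* Let $M$ be a monoid, and let $C=A\cup B$ be an $M$-act with $A$ and $B$ subacts of $C$. Let $A$ and $B$ have presentations $\langle X\,|\,R\rangle$ and $\langle Y\,|\,S\rangle$ respectively. If $A\cap B\neq\emptyset$, let $U$ be a generating set for $A\cap B$; otherwise let $U=\emptyset$. For each $u\in U$, choose $\rho_X(u)\in F_X$ and $\rho_Y(u)\in F_Y$ which both represent $u$ in $C$, and define $$T=\{\rho_X(u)=\rho_Y(u) : u\in U\}.$$ Then $C$ is defined by the presentation $\langle X\cup Y\,|\,R\cup S\cup T\rangle$.
   Context: Let $M$ be a monoid with identity $1$. A (right) $M$-act is a non-empty set $A$ with a map $A\times M\to A$, $(a,m)\mapsto am$, with $a(mn)=(am)n$ and $a1=a$. A subact of $A$ is a non-empty subset $B$ with $bm\in B$ for all $b\in B$, $m\in M$. A subset $U$ generates $A$ if every $a\in A$ is $um$ for some $u\in U$, $m\in M$. A congruence on $A$ is an equivalence relation $\rho$ with $(a,b)\in\rho\Rightarrow(am,bm)\in\rho$ for all $m\in M$. For a set $X$, $F_X=X\times M$ is the free $M$-act with $(x,m)n=(x,mn)$; one writes $x\cdot m$ for $(x,m)$ and $x$ for $(x,1)$. For $X\subseteq Z$ we regard $F_X\subseteq F_Z$. A presentation $\langle X\,|\,R\rangle$ consists of a non-empty set $X$ and a set $R\subseteq F_X\times F_X$ of relations; $(u,v)\in R$ is also written $u=v$. An $M$-act $A$ is defined by (has presentation) $\langle X\,|\,R\rangle$ if $A\cong F_X/\rho$, where $\rho$ is the smallest congruence on $F_X$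 containing $R$. The generators are regarded as elements of the act (so here $X\subseteq A$ and $Y\subseteq B$ are generating sets), and $x\cdot m\in F_X$ represents the element $xm$. *)

theory Defs
  imports Main
begin

text \<open>
  The monoid is a type \<open>'m\<close> of class \<open>monoid_mult\<close>. A right act is a carrier set together with
  an action on the ambient type, which is only constrained on the carrier.
\<close>

definition right_act :: "'a set \<Rightarrow> ('a \<Rightarrow> 'm::monoid_mult \<Rightarrow> 'a) \<Rightarrow> bool" where
  "right_act A act \<longleftrightarrow>
     A \<noteq> {} \<and>
     (\<forall>a\<in>A. \<forall>m. act a m \<in> A) \<and>
     (\<forall>a\<in>A. \<forall>m n. act a (m * n) = act (act a m) n) \<and>
     (\<forall>a\<in>A. act a 1 = a)"

definition subact :: "'a set \<Rightarrow> 'a set \<Rightarrow> ('a \<Rightarrow> 'm::monoid_mult \<Rightarrow> 'a) \<Rightarrow> bool" where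
  "subact B A act \<longleftrightarrow> B \<noteq> {} \<and> B \<subseteq> A \<and> (\<forall>b\<in>B. \<forall>m. act b m \<in> B)"

definition generates :: "'a set \<Rightarrow> 'a set \<Rightarrow> ('a \<Rightarrow> 'm::monoid_mult \<Rightarrow> 'a) \<Rightarrow> bool" where
  "generates U A act \<longleftrightarrow> U \<subseteq> A \<and> (\<forall>a\<in>A. \<exists>u\<in>U. \<exists>m. a = act u m)"

definition congruence :: "'a set \<Rightarrow> ('a \<Rightarrow> 'm::monoid_mult \<Rightarrow> 'a) \<Rightarrow> ('a \<times> 'a) set \<Rightarrow> bool" where
  "congruence A act \<rho> \<longleftrightarrow>
     equiv A \<rho> \<and> (\<forall>a b m. (a, b) \<in> \<rho> \<longrightarrow> (act a m, act b m) \<in> \<rho>)"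

text \<open>For \<open>R \<subseteq> A \<times> A\<close> this is the smallest congruence on \<open>A\<close> containing \<open>R\<close>.\<close>

definition cong_gen ::
  "'a set \<Rightarrow> ('a \<Rightarrow> 'm::monoid_mult \<Rightarrow> 'a) \<Rightarrow> ('a \<times> 'a) set \<Rightarrow> ('a \<times> 'a) set" where
  "cong_gen A act R = \<Inter> {\<rho>. congruence A act \<rho> \<and> R \<subseteq> \<rho>}"

text \<open>
  The action on the quotient \<open>A // \<rho>\<close>: the class \<open>K\<close> is sent to the class containing
  \<open>act a m\<close> for any (equivalently, every) \<open>a \<in> K\<close>; see \<open>quot_act_class\<close> below.
\<close>

definition quot_act ::
  "('a \<Rightarrow> 'm::monoid_mult \<Rightarrow> 'a) \<Rightarrow> ('a \<times> 'a) set \<Rightarrow> 'a set \<Rightarrow> 'm \<Rightarrow> 'a set" where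
  "quot_act act \<rho> K m = \<rho> `` ((\<lambda>a. act a m) ` K)"

lemma quot_act_class:
  assumes "congruence A act \<rho>" and "a \<in> A"
  shows "quot_act act \<rho> (\<rho> `` {a}) m = \<rho> `` {act a m}"
proof -
  have eq: "equiv A \<rho>" and c: "\<And>x y. (x, y) \<in> \<rho> \<Longrightarrow> (act x m, act y m) \<in> \<rho>"
    using assms(1) by (auto simp: congruence_def)
  have "\<rho> `` {act x m} = \<rho> `` {act a m}" if "(a, x) \<in> \<rho>" for x
    using equiv_class_eq[OF eq c[OF that]] by simp
  moreover have "(a, a) \<in> \<rho>"
    using eq assms(2) by (auto simp: equiv_def refl_on_def)
  ultimately show ?thesis
    unfolding quot_act_def by blast
qed

definition act_iso ::
  "('a \<Rightarrow> 'b) \<Rightarrow> 'a set \<Rightarrow> ('a \<Rightarrow> 'm::monoid_mult \<Rightarrow> 'a) \<Rightarrow> 'b set \<Rightarrow> ('b \<Rightarrow> 'm \<Rightarrow> 'b) \<Rightarrow> bool" where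
  "act_iso \<phi> A actA B actB \<longleftrightarrow>
     bij_betw \<phi> A B \<and> (\<forall>a\<in>A. \<forall>m. \<phi> (actA a m) = actB (\<phi> a) m)"

definition free_act :: "'x set \<Rightarrow> ('x \<times> 'm::monoid_mult) set" where
  "free_act X = X \<times> UNIV"

definition free_mult :: "'x \<times> 'm::monoid_mult \<Rightarrow> 'm \<Rightarrow> 'x \<times> 'm" where
  "free_mult w n = (fst w, snd w * n)"

text \<open>
  The map \<open>gen\<close> records which element of the act each generator is regarded as; for a set of
  generators that is literally a subset of the act, \<open>gen\<close> is the identity. The isomorphism from
  the quotient of the free act is required to respect this identification of the generators, so
  that \<open>(x, m)\<close> represents \<open>act (gen x) m\<close>.
\<close>

definition has_presentation ::
  "('x \<Rightarrow> 'a) \<Rightarrow> 'a set \<Rightarrow> ('a \<Rightarrow> 'm::monoid_mult \<Rightarrow> 'a) \<Rightarrow>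
   'x set \<Rightarrow> (('x \<times> 'm) \<times> ('x \<times> 'm)) set \<Rightarrow> bool" where
  "has_presentation gen A act X R \<longleftrightarrow>
     X \<noteq> {} \<and> R \<subseteq> free_act X \<times> free_act X \<and>
     (let \<rho> = cong_gen (free_act X) free_mult R in
        \<exists>\<phi>. act_iso \<phi> (free_act X // \<rho>) (quot_act free_mult \<rho>) A act \<and>
            (\<forall>x\<in>X. \<phi> (\<rho> `` {(x, 1)}) = gen x))"

definition represents ::
  "('x \<Rightarrow> 'a) \<Rightarrow> ('a \<Rightarrow> 'm::monoid_mult \<Rightarrow> 'a) \<Rightarrow> 'x \<times> 'm \<Rightarrow> 'a \<Rightarrow> bool" where
  "represents gen act w a \<longleftrightarrow> a = act (gen (fst w)) (snd w)"

end

theory Submission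
  imports Defs
begin

text \<open>
  An act has presentation \<open>\<langle>X | R\<rangle>\<close> iff the evaluation map \<open>F\<^sub>X \<rightarrow> A\<close> is onto and its kernel is the
  congruence generated by \<open>R\<close>. For \<open>C = A \<union> B\<close>, two words over \<open>X\<close> (or two over \<open>Y\<close>) with equal
  value are already identified by \<open>R\<close> (or \<open>S\<close>). If \<open>v \<in> F\<^sub>X\<close> and \<open>w \<in> F\<^sub>Y\<close> have the same value, it
  lies in \<open>A \<inter> B\<close>, so it is \<open>um\<close> with \<open>u \<in> U\<close>, and
  \<open>v \<sim> \<rho>\<^sub>X(u)m \<sim> \<rho>\<^sub>Y(u)m \<sim> w\<close> by \<open>R\<close>, \<open>T\<close> and \<open>S\<close>.
\<close>

section \<open>Words and their values in an act\<close>

definition eval_word ::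
  "('x \<Rightarrow> 'a) \<Rightarrow> ('a \<Rightarrow> 'm::monoid_mult \<Rightarrow> 'a) \<Rightarrow> 'x \<times> 'm \<Rightarrow> 'a" where
  "eval_word gen act w = act (gen (fst w)) (snd w)"

text \<open>Membership in \<open>free_act X\<close> is imposed on both words because a congruence on
  \<open>free_act X\<close> must be a relation on that set, whereas \<open>eval_word\<close> is
  total on the ambient type.\<close>

definition eval_kernel ::
  "('x \<Rightarrow> 'a) \<Rightarrow> ('a \<Rightarrow> 'm::monoid_mult \<Rightarrow> 'a) \<Rightarrow> 'x set \<Rightarrow> (('x \<times> 'm) \<times> ('x \<times> 'm)) set" where
  "eval_kernel gen act X =
     {(v, w). v \<in> free_act X \<and> w \<in> free_act X \<and> eval_word gen act v = eval_word gen act w}"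

lemma free_mult_in_free_act: "w \<in> free_act X \<Longrightarrow> free_mult w m \<in> free_act X"
  by (auto simp: free_act_def free_mult_def)

lemma free_act_Un: "free_act (X \<union> Y) = free_act X \<union> free_act Y"
  by (auto simp: free_act_def)

section \<open>Congruences and the smallest congruence containing a relation\<close>

lemma congruenceI:
  assumes "\<rho> \<subseteq> A \<times> A" and "\<And>a. a \<in> A \<Longrightarrow> (a, a) \<in> \<rho>"
    and "\<And>a b. (a, b) \<in> \<rho> \<Longrightarrow> (b, a) \<in> \<rho>"
    and "\<And>a b c. (a, b) \<in> \<rho> \<Longrightarrow> (b, c) \<in> \<rho> \<Longrightarrow> (a, c) \<in> \<rho>"
    and "\<And>a b m. (a, b) \<in> \<rho> \<Longrightarrow> (act a m, act b m) \<in> \<rho>"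
  shows "congruence A act \<rho>"
  unfolding congruence_def
  by (intro conjI equivI refl_onI symI transI allI impI) (use assms in blast)+

lemma congruence_subset: "congruence A act \<rho> \<Longrightarrow> \<rho> \<subseteq> A \<times> A"
  and congruence_refl: "congruence A act \<rho> \<Longrightarrow> a \<in> A \<Longrightarrow> (a, a) \<in> \<rho>"
  and congruence_sym: "congruence A act \<rho> \<Longrightarrow> (a, b) \<in> \<rho> \<Longrightarrow> (b, a) \<in> \<rho>"
  and congruence_trans:
    "congruence A act \<rho> \<Longrightarrow> (a, b) \<in> \<rho> \<Longrightarrow> (b, c) \<in> \<rho> \<Longrightarrow> (a, c) \<in> \<rho>"
  and congruence_act: "congruence A act \<rho> \<Longrightarrow> (a, b) \<in> \<rho> \<Longrightarrow> (act a m, act b m) \<in> \<rho>"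
  unfolding congruence_def equiv_def refl_on_def sym_def trans_def by blast+

lemma cong_gen_least: "congruence A act \<rho> \<Longrightarrow> R \<subseteq> \<rho> \<Longrightarrow> cong_gen A act R \<subseteq> \<rho>"
  by (auto simp: cong_gen_def)

lemma cong_gen_base: "R \<subseteq> cong_gen A act R"
  by (auto simp: cong_gen_def)

lemma congruence_cong_gen:
  assumes "\<And>a m. a \<in> A \<Longrightarrow> act a m \<in> A" and "R \<subseteq> A \<times> A"
  shows "congruence A act (cong_gen A act R)"
proof (rule congruenceI)
  \<comment> \<open>The full relation belongs to the family being intersected, so the intersection
    is confined to pairs over \<open>A\<close>. The remaining congruence laws pass to any
    intersection of congruences.\<close>
  have "congruence A act (A \<times> A)"
    by (rule congruenceI) (use assms(1) in auto)
  then show "cong_gen A act R \<subseteq> A \<times> A"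
    using assms(2) by (rule cong_gen_least)
next
  fix a b c
  assume "(a, b) \<in> cong_gen A act R" "(b, c) \<in> cong_gen A act R"
  then show "(a, c) \<in> cong_gen A act R"
    unfolding cong_gen_def by (blast intro: congruence_trans)
next
  fix a b
  assume ab: "(a, b) \<in> cong_gen A act R"
  then show "(b, a) \<in> cong_gen A act R"
    unfolding cong_gen_def by (blast intro: congruence_sym)
  show "(act a m, act b m) \<in> cong_gen A act R" for m
    using ab unfolding cong_gen_def by (blast intro: congruence_act)
qed (unfold cong_gen_def, blast intro: congruence_refl)

lemma congruence_restrict:
  assumes "congruence A act \<rho>" and "B \<subseteq> A" and "\<And>b m. b \<in> B \<Longrightarrow> act b m \<in> B"
  shows "congruence B act (\<rho> \<inter> B \<times> B)"
proof (rule congruenceI)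
  fix a b c
  assume "(a, b) \<in> \<rho> \<inter> B \<times> B" "(b, c) \<in> \<rho> \<inter> B \<times> B"
  then show "(a, c) \<in> \<rho> \<inter> B \<times> B"
    using congruence_trans[OF assms(1)] by blast
qed (use assms(2,3) congruence_refl[OF assms(1)] congruence_sym[OF assms(1)]
    congruence_act[OF assms(1)] in blast)+

section \<open>Presentations described by the kernel of evaluation\<close>

lemma eval_word_free_mult:
  assumes "right_act A act" and "gen (fst w) \<in> A"
  shows "eval_word gen act (free_mult w m) = act (eval_word gen act w) m"
  using assms by (simp add: right_act_def eval_word_def free_mult_def)

lemma congruence_eval_kernel:
  assumes "right_act A act" and "gen ` X \<subseteq> A"
  shows "congruence (free_act X) free_mult (eval_kernel gen act X)"
proof (rule congruenceI)
  fix v w m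
  assume vw: "(v, w) \<in> eval_kernel gen act X"
  then have "gen (fst v) \<in> A" "gen (fst w) \<in> A"
    using assms(2) by (auto simp: eval_kernel_def free_act_def)
  with vw show "(free_mult v m, free_mult w m) \<in> eval_kernel gen act X"
    by (simp add: eval_kernel_def free_mult_in_free_act eval_word_free_mult[OF assms(1)])
qed (auto simp: eval_kernel_def)

text \<open>This trades the isomorphism with a quotient for equations between sets of words.
  Forwards, the isomorphism is forced to send the class of each word to its value; backwards, it is
  the first isomorphism theorem applied to evaluation.\<close>

lemma has_presentation_iff:
  assumes act: "right_act A act"
  shows "has_presentation gen A act X R \<longleftrightarrow>
    X \<noteq> {} \<and> R \<subseteq> free_act X \<times> free_act X \<and> gen ` X \<subseteq> A \<and>
    eval_word gen act ` free_act X = A \<and>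
    cong_gen (free_act X) free_mult R = eval_kernel gen act X"
    (is "?pres \<longleftrightarrow> ?ker")
proof
  let ?F = "free_act X" and ?ev = "eval_word gen act"
  let ?\<rho> = "cong_gen ?F free_mult R"
  assume ?pres
  then obtain \<phi> where ne: "X \<noteq> {}" and R: "R \<subseteq> ?F \<times> ?F"
    and iso: "act_iso \<phi> (?F // ?\<rho>) (quot_act free_mult ?\<rho>) A act"
    and \<phi>_gen: "\<And>x. x \<in> X \<Longrightarrow> \<phi> (?\<rho> `` {(x, 1)}) = gen x"
    by (auto simp: has_presentation_def Let_def)
  have cong: "congruence ?F free_mult ?\<rho>"
    by (rule congruence_cong_gen[OF free_mult_in_free_act R])
  then have equiv: "equiv ?F ?\<rho>"
    by (simp add: congruence_def)
  have bij: "bij_betw \<phi> (?F // ?\<rho>) A"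
    using iso by (simp add: act_iso_def)
  \<comment> \<open>Since \<open>(x, m)\<close> is \<open>(x, 1)\<close> acted on by
    \<open>m\<close>, the values of \<open>\<phi>\<close> on the generators and its compatibility
    with the action determine it.\<close>
  have \<phi>_class: "\<phi> (?\<rho> `` {w}) = ?ev w" if w: "w \<in> ?F" for w
  proof -
    obtain x m where [simp]: "w = (x, m)"
      by (cases w)
    have x: "x \<in> X" "(x, 1) \<in> ?F"
      using w by (auto simp: free_act_def)
    have "\<phi> (?\<rho> `` {w}) = \<phi> (quot_act free_mult ?\<rho> (?\<rho> `` {(x, 1)}) m)"
      by (simp add: quot_act_class[OF cong x(2)] free_mult_def)
    also have "\<dots> = act (\<phi> (?\<rho> `` {(x, 1)})) m"
      using iso quotientI[OF x(2), of ?\<rho>] unfolding act_iso_def by blast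
    finally show ?thesis
      by (simp add: \<phi>_gen[OF x(1)] eval_word_def)
  qed
  have "gen ` X \<subseteq> A"
  proof
    fix a assume "a \<in> gen ` X"
    then obtain x where "x \<in> X" "a = \<phi> (?\<rho> `` {(x, 1)})"
      using \<phi>_gen by auto
    then show "a \<in> A"
      using bij_betwE[OF bij] by (auto simp: free_act_def intro: quotientI)
  qed
  moreover have "?ev ` ?F = A"
  proof -
    have "?ev ` ?F = \<phi> ` (\<lambda>w. ?\<rho> `` {w}) ` ?F"
      by (simp add: image_image \<phi>_class cong: image_cong)
    also have "(\<lambda>w. ?\<rho> `` {w}) ` ?F = ?F // ?\<rho>"
      by (auto simp: quotient_def)
    finally show ?thesis
      using bij by (simp add: bij_betw_def)
  qed
  \<comment> \<open>For words in \<open>?F\<close>, injectivity of \<open>\<phi>\<close> turns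
    equality of values into equality of classes. Outside \<open>?F\<close> neither relation has any
    pairs.\<close>
  moreover have "(v, w) \<in> ?\<rho> \<longleftrightarrow> (v, w) \<in> eval_kernel gen act X" for v w
  proof (cases "v \<in> ?F \<and> w \<in> ?F")
    case True
    then have "(v, w) \<in> ?\<rho> \<longleftrightarrow> ?\<rho> `` {v} = ?\<rho> `` {w}"
      by (simp add: eq_equiv_class_iff[OF equiv])
    also have "\<dots> \<longleftrightarrow> \<phi> (?\<rho> `` {v}) = \<phi> (?\<rho> `` {w})"
      using bij True by (auto simp: bij_betw_def inj_on_eq_iff quotientI)
    finally show ?thesis
      using True by (simp add: \<phi>_class eval_kernel_def)
  next
    case False
    then show ?thesis
      using congruence_subset[OF cong] by (auto simp: eval_kernel_def)
  qed
  ultimately show ?ker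
    using ne R by auto
next
  let ?F = "free_act X" and ?ev = "eval_word gen act"
  \<comment> \<open>From here on \<open>?\<rho>\<close> is the kernel itself; by the last conjunct
    of \<open>?ker\<close> it is the congruence generated by \<open>R\<close>, so the quotient to
    treat is the same.\<close>
  let ?\<rho> = "eval_kernel gen act X"
  assume ker: ?ker
  then have genA: "gen ` X \<subseteq> A" and onto: "?ev ` ?F = A"
    by auto
  have cong: "congruence ?F free_mult ?\<rho>"
    using act genA by (rule congruence_eval_kernel)
  \<comment> \<open>The chosen representative is immaterial: all words in one class of the kernel
    have the same value.\<close>
  define \<phi> where "\<phi> K = ?ev (SOME w. w \<in> K)" for K
  have \<phi>_class: "\<phi> (?\<rho> `` {w}) = ?ev w" if "w \<in> ?F" for w
  proof -
    have "w \<in> ?\<rho> `` {w}"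
      using that by (simp add: eval_kernel_def)
    moreover have "?ev v = ?ev w" if "v \<in> ?\<rho> `` {w}" for v
      using that by (simp add: eval_kernel_def)
    ultimately show ?thesis
      unfolding \<phi>_def by (rule someI2)
  qed
  have "inj_on \<phi> (?F // ?\<rho>)"
  proof (rule inj_onI)
    fix K L assume "K \<in> ?F // ?\<rho>" "L \<in> ?F // ?\<rho>" and eq: "\<phi> K = \<phi> L"
    then obtain v w where vw: "v \<in> ?F" "K = ?\<rho> `` {v}" "w \<in> ?F" "L = ?\<rho> `` {w}"
      by (auto elim!: quotientE)
    with eq have "?ev v = ?ev w"
      by (simp add: \<phi>_class)
    with vw show "K = L"
      by (auto simp: eval_kernel_def)
  qed
  moreover have "\<phi> ` (?F // ?\<rho>) = A"
  proof -
    have "?F // ?\<rho> = (\<lambda>w. ?\<rho> `` {w}) ` ?F"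
      by (auto simp: quotient_def)
    then show ?thesis
      using onto by (simp add: image_image \<phi>_class cong: image_cong)
  qed
  moreover have "\<phi> (quot_act free_mult ?\<rho> K m) = act (\<phi> K) m" if K: "K \<in> ?F // ?\<rho>" for K m
  proof -
    obtain w where w: "w \<in> ?F" "K = ?\<rho> `` {w}"
      using K by (auto elim!: quotientE)
    then have "gen (fst w) \<in> A"
      using genA by (auto simp: free_act_def)
    then show ?thesis
      using w by (simp add: quot_act_class[OF cong] \<phi>_class free_mult_in_free_act
          eval_word_free_mult[OF act])
  qed
  moreover have "\<phi> (?\<rho> `` {(x, 1)}) = gen x" if "x \<in> X" for x
  proof -
    have "gen x \<in> A" "(x, 1) \<in> ?F"
      using that genA by (auto simp: free_act_def)
    then show ?thesis
      using act \<phi>_class[of "(x, 1)"] by (simp add: eval_word_def right_act_def)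
  qed
  ultimately have "act_iso \<phi> (?F // ?\<rho>) (quot_act free_mult ?\<rho>) A act
      \<and> (\<forall>x\<in>X. \<phi> (?\<rho> `` {(x, 1)}) = gen x)"
    by (simp add: act_iso_def bij_betw_def)
  with ker show ?pres
    by (auto simp: has_presentation_def Let_def)
qed

section \<open>From the two subacts to their union\<close>

lemma right_act_subact: "right_act C act \<Longrightarrow> subact A C act \<Longrightarrow> right_act A act"
  unfolding right_act_def subact_def by blast

text \<open>The congruence generated by \<open>Q\<close> over the larger set, cut down to words over
  \<open>X\<close>, is a congruence on \<open>free_act X\<close> containing \<open>R\<close>.
  Minimality of the one generated by \<open>R\<close> gives the inclusion.\<close>

lemma cong_gen_mono_carrier:
  assumes "X \<subseteq> Z" and "R \<subseteq> free_act X \<times> free_act X" and "R \<subseteq> Q"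
    and "Q \<subseteq> free_act Z \<times> free_act Z"
  shows "cong_gen (free_act X) free_mult R \<subseteq> cong_gen (free_act Z) free_mult Q"
proof -
  let ?\<sigma> = "cong_gen (free_act Z) free_mult Q"
  have "congruence (free_act Z) free_mult ?\<sigma>"
    by (rule congruence_cong_gen[OF free_mult_in_free_act assms(4)])
  moreover have "free_act X \<subseteq> free_act Z"
    using assms(1) by (auto simp: free_act_def)
  ultimately have "congruence (free_act X) free_mult (?\<sigma> \<inter> free_act X \<times> free_act X)"
    by (rule congruence_restrict) (rule free_mult_in_free_act)
  moreover have "R \<subseteq> ?\<sigma> \<inter> free_act X \<times> free_act X"
    using assms(2) subset_trans[OF assms(3) cong_gen_base] by (rule Int_greatest[rotated])
  ultimately have "cong_gen (free_act X) free_mult R \<subseteq> ?\<sigma> \<inter> free_act X \<times> free_act X"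
    by (rule cong_gen_least)
  then show ?thesis
    by simp
qed

theorem theorem5p5:
  fixes act :: "'c \<Rightarrow> 'm::monoid_mult \<Rightarrow> 'c"
    and gen :: "'x \<Rightarrow> 'c"
    and A B C U :: "'c set"
    and X Y :: "'x set"
    and R S :: "(('x \<times> 'm) \<times> ('x \<times> 'm)) set"
    and rho_X rho_Y :: "'c \<Rightarrow> 'x \<times> 'm"
  assumes "right_act C act"
    and "subact A C act" and "subact B C act" and "C = A \<union> B"
    and "has_presentation gen A act X R"
    and "has_presentation gen B act Y S"
    and "A \<inter> B \<noteq> {} \<Longrightarrow> generates U (A \<inter> B) act"
    and "A \<inter> B = {} \<Longrightarrow> U = {}"
    and "\<forall>u\<in>U. rho_X u \<in> free_act X \<and> represents gen act (rho_X u) u"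
    and "\<forall>u\<in>U. rho_Y u \<in> free_act Y \<and> represents gen act (rho_Y u) u"
  shows "has_presentation gen C act (X \<union> Y) (R \<union> S \<union> {(rho_X u, rho_Y u) | u. u \<in> U})"
proof -
  let ?ev = "eval_word gen act" and ?Z = "X \<union> Y"
  let ?T = "{(rho_X u, rho_Y u) | u. u \<in> U}"
  let ?Q = "R \<union> S \<union> ?T"
  let ?\<sigma> = "cong_gen (free_act ?Z) free_mult ?Q"
  have actA: "right_act A act" and actB: "right_act B act"
    using assms(1-3) by (auto intro: right_act_subact)
  have A: "X \<noteq> {}" "R \<subseteq> free_act X \<times> free_act X" "gen ` X \<subseteq> A" "?ev ` free_act X = A"
    "cong_gen (free_act X) free_mult R = eval_kernel gen act X"
    using assms(5) by (simp_all add: has_presentation_iff[OF actA])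
  have B: "S \<subseteq> free_act Y \<times> free_act Y" "gen ` Y \<subseteq> B" "?ev ` free_act Y = B"
    "cong_gen (free_act Y) free_mult S = eval_kernel gen act Y"
    using assms(6) by (simp_all add: has_presentation_iff[OF actB])
  have rho_X: "rho_X u \<in> free_act X" "?ev (rho_X u) = u" if "u \<in> U" for u
    using assms(9) that by (auto simp: represents_def eval_word_def)
  have rho_Y: "rho_Y u \<in> free_act Y" "?ev (rho_Y u) = u" if "u \<in> U" for u
    using assms(10) that by (auto simp: represents_def eval_word_def)
  have Q: "?Q \<subseteq> free_act ?Z \<times> free_act ?Z"
    using A(2) B(1) rho_X(1) rho_Y(1) unfolding free_act_Un by blast
  have genC: "gen ` ?Z \<subseteq> C"
    using A(3) B(2) assms(4) by auto
  have cong: "congruence (free_act ?Z) free_mult ?\<sigma>"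
    by (rule congruence_cong_gen[OF free_mult_in_free_act Q])
  \<comment> \<open>The presentation of \<open>A\<close> says that its kernel is generated by
    \<open>R\<close>, so enlarging generators and relations keeps all identifications between words
    over \<open>X\<close>.\<close>
  have kerX: "eval_kernel gen act X \<subseteq> ?\<sigma>"
    unfolding A(5)[symmetric] using A(2) Q by (intro cong_gen_mono_carrier) auto
  have kerY: "eval_kernel gen act Y \<subseteq> ?\<sigma>"
    unfolding B(4)[symmetric] using B(1) Q by (intro cong_gen_mono_carrier) auto
  have mixed: "(v, w) \<in> ?\<sigma>"
    if v: "v \<in> free_act X" and w: "w \<in> free_act Y" and eq: "?ev v = ?ev w" for v w
  proof -
    \<comment> \<open>The common value witnesses that \<open>A\<close> and \<open>B\<close> meet, so
      \<open>U\<close> generates their intersection. If they are disjoint, no such pair of words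
      exists.\<close>
    have "?ev v \<in> A \<inter> B"
      using imageI[OF v, of ?ev] imageI[OF w, of ?ev] eq A(4) B(3) by simp
    then obtain u m where u: "u \<in> U" and ev: "?ev v = act u m"
      using assms(7) unfolding generates_def by blast
    \<comment> \<open>The laws of an act hold only on its carrier, so pulling \<open>m\<close> out
      of an evaluation requires the underlying generator to lie in \<open>A\<close> or
      \<open>B\<close>.\<close>
    have gens: "gen (fst (rho_X u)) \<in> A" "gen (fst (rho_Y u)) \<in> B"
      using rho_X(1)[OF u] rho_Y(1)[OF u] A(3) B(2) by (auto simp: free_act_def)
    have "(v, free_mult (rho_X u) m) \<in> eval_kernel gen act X"
      using v ev rho_X[OF u] gens
      by (simp add: eval_kernel_def free_mult_in_free_act eval_word_free_mult[OF actA])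
    moreover have "(free_mult (rho_X u) m, free_mult (rho_Y u) m) \<in> ?\<sigma>"
      using u by (intro congruence_act[OF cong] subsetD[OF cong_gen_base]) blast
    moreover have "(free_mult (rho_Y u) m, w) \<in> eval_kernel gen act Y"
      using w ev eq rho_Y[OF u] gens
      by (simp add: eval_kernel_def free_mult_in_free_act eval_word_free_mult[OF actB])
    ultimately show ?thesis
      using kerX kerY congruence_trans[OF cong] by blast
  qed
  have "?\<sigma> = eval_kernel gen act ?Z"
  proof
    have "R \<subseteq> eval_kernel gen act X" "S \<subseteq> eval_kernel gen act Y"
      unfolding A(5)[symmetric] B(4)[symmetric] by (rule cong_gen_base)+
    \<comment> \<open>A single map \<open>gen\<close> evaluates both alphabets, so the kernels over
      \<open>X\<close> and \<open>Y\<close> lie in the kernel over \<open>?Z\<close>. Both sides of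
      a pair in \<open>?T\<close> have value \<open>u\<close>.\<close>
    then have "?Q \<subseteq> eval_kernel gen act ?Z"
      using rho_X rho_Y by (fastforce simp: eval_kernel_def free_act_Un)
    then show "?\<sigma> \<subseteq> eval_kernel gen act ?Z"
      by (rule cong_gen_least[OF congruence_eval_kernel[OF assms(1) genC]])
    show "eval_kernel gen act ?Z \<subseteq> ?\<sigma>"
    proof (rule subrelI)
      fix v w assume "(v, w) \<in> eval_kernel gen act ?Z"
      \<comment> \<open>Every word over \<open>?Z\<close> is a word over \<open>X\<close> or over
        \<open>Y\<close>, possibly both. The last case is stated with \<open>w\<close> first so that
        \<open>mixed\<close> applies, and symmetry then reverses the pair.\<close>
      then consider "(v, w) \<in> eval_kernel gen act X" | "(v, w) \<in> eval_kernel gen act Y"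
        | "v \<in> free_act X" "w \<in> free_act Y" "?ev v = ?ev w"
        | "w \<in> free_act X" "v \<in> free_act Y" "?ev w = ?ev v"
        by (auto simp: eval_kernel_def free_act_Un)
      then show "(v, w) \<in> ?\<sigma>"
        by cases (use kerX kerY mixed congruence_sym[OF cong] in blast)+
    qed
  qed
  moreover have "?ev ` free_act ?Z = C"
    using A(4) B(3) assms(4) by (simp add: free_act_Un image_Un)
  ultimately show ?thesis
    using A(1) Q genC by (simp add: has_presentation_iff[OF assms(1)])
qed

end
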